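(* Let $X,Y$ be random variables with values in finite sets $\mathcal X,\mathcal Y$ and let $U^1$ be a binary random variable such that $U^1\to X\to Y$ is a Markov chain. Let $0<\beta_1<\beta<1/2$. For $N=2^n$ let $P_{\bar U^1\bar X\bar Y}$ be the law of $N$ i.i.d. copies of $(U^1,X,Y)$, and let $Q_{\bar U_A^1\bar X\bar Y}$ be the law of $(\bar U_A^1,\bar X,\bar Y)$ produced by Terminal A's first-round encoding procedure described in the context (with $\delta_N=2^{-N^\beta}$). Then, as $N\to\infty$, $$\big\|Q_{\bar U_A^1\bar X\bar Y}-P_{\bar U^1\bar X\bar Y}\big\|_1=O(2^{-N^{\beta_1}}).$$
   Context: Polarization notation. $N=2^n$, $n\in\mathbb N$; $[N]=\{1,\dots,N\}$; $\delta_N=2^{-N^\beta}$. A bar denotes an $N$-vector, $w^{1:k}=(w^1,\dots,w^k)$. $G_N=B_NF^{\otimes n}$ over $\mathbb F_2$, where $F=\begin{pmatrix}1&0\\1&1\end{pmatrix}$, $\otimes$ is the Kronecker product and $B_N$ is the $N\times N$ bit-reversal permutation matrix. For a binary random variable $T$ and a discrete random variable $V$, $Z(T|V)=2\sum_{v}P_V(v)\sqrt{P_{T|V}(0|v)P_{T|V}(1|v)}$. Let $(\bar X,\bar Y,\bar U^1)$ be $N$ i.i.d. copies of $(X,Y,U^1)$ and $\bar V^1=\bar U^1G_N$; $P$ denotes the joint law of $(\bar X,\bar Y,\bar U^1,\bar V^1)$ and all its marginals and conditionals (conditional laws given zero-probability events are fixed arbitrarily). Put $\mathcal L_{U^1}=\{i\in[N]:Z((V^1)^i|(V^1)^{1:i-1})\le\delta_N\}$,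 $\mathcal H_{U^1|X}=\{i\in[N]:Z((V^1)^i|(V^1)^{1:i-1},\bar X)\ge1-\delta_N\}$, and (complements in $[N]$) $\mathcal F_r=\mathcal L^c_{U^1}\cap\mathcal H_{U^1|X}$, $\mathcal F_d=\mathcal L_{U^1}$, $\mathcal I=\mathcal L^c_{U^1}\cap\mathcal H^c_{U^1|X}$. Encoding procedure of Terminal A. The pair $(\bar X,\bar Y)$ is distributed as $N$ i.i.d. copies of $(X,Y)$. Given $\bar X=\bar x$ (and independently of $\bar Y$ given $\bar X$), Terminal A generates $\bar v_A^1$ successively, for $i=1,\dots,N$, from the conditional distribution $Q((v_A^1)^i|(v_A^1)^{1:i-1},\bar x)$ equal to $1/2$ if $i\in\mathcal F_r$; to $P_{(V^1)^i|(V^1)^{1:i-1}}((v_A^1)^i|(v_A^1)^{1:i-1})$ if $i\in\mathcal F_d$; and to $P_{(V^1)^i|(V^1)^{1:i-1}\bar X}((v_A^1)^i|(v_A^1)^{1:i-1},\bar x)$ if $i\in\mathcal I$. Then $\bar U_A^1=\bar V_A^1G_N$. $\|\cdot\|_1$ is the $\ell_1$ distance between probability mass functions. The constant in $O(\cdot)$ does not depend on $N$. *)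

theory Defs
  imports
    "HOL-Probability.Probability_Mass_Function"
    "HOL-Library.Landau_Symbols"
    "HOL-Library.Z2"
    "Jordan_Normal_Form.Matrix"
begin

section \<open>Discrete random variables\<close>

text \<open>Random variables are functions on the sample space of a probability mass function.
  Since \<^const>\<open>cond_pmf\<close> is unspecified when one conditions on a null event, \<open>cond_law p S T t\<close>
  is meaningful only when \<open>T\<close> takes the value \<open>t\<close> with positive probability.  For other values
  of \<open>t\<close> the law \<open>cond_law_or\<close> is supplied by an arbitrary family \<open>d\<close>.\<close>

definition cond_law :: "'w pmf \<Rightarrow> ('w \<Rightarrow> 'a) \<Rightarrow> ('w \<Rightarrow> 'b) \<Rightarrow> 'b \<Rightarrow> 'a pmf" where
  "cond_law p S T t = map_pmf S (cond_pmf p {\<omega>. T \<omega> = t})"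

definition cond_law_or ::
    "('b \<Rightarrow> 'a pmf) \<Rightarrow> 'w pmf \<Rightarrow> ('w \<Rightarrow> 'a) \<Rightarrow> ('w \<Rightarrow> 'b) \<Rightarrow> 'b \<Rightarrow> 'a pmf" where
  "cond_law_or d p S T t = (if t \<in> set_pmf (map_pmf T p) then cond_law p S T t else d t)"

text \<open>\<open>A \<rightarrow> B \<rightarrow> C\<close>: given \<open>(A, B)\<close>, the conditional law of \<open>C\<close> depends on \<open>B\<close> only.\<close>

definition markov_chain :: "'w pmf \<Rightarrow> ('w \<Rightarrow> 'a) \<Rightarrow> ('w \<Rightarrow> 'b) \<Rightarrow> ('w \<Rightarrow> 'c) \<Rightarrow> bool" where
  "markov_chain p A B C \<longleftrightarrow>
     (\<forall>(a, b) \<in> set_pmf (map_pmf (\<lambda>\<omega>. (A \<omega>, B \<omega>)) p).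
        cond_law p C (\<lambda>\<omega>. (A \<omega>, B \<omega>)) (a, b) = cond_law p C B b)"

text \<open>The Bhattacharyya parameter \<open>Z(T|V)\<close>.\<close>

definition bhatt :: "'w pmf \<Rightarrow> ('w \<Rightarrow> bit) \<Rightarrow> ('w \<Rightarrow> 'v) \<Rightarrow> real" where
  "bhatt p T V =
     2 * (\<Sum>\<^sub>\<infinity>v\<in>set_pmf (map_pmf V p).
            pmf (map_pmf V p) v * sqrt (pmf (cond_law p T V v) 0 * pmf (cond_law p T V v) 1))"

definition l1_dist :: "'a pmf \<Rightarrow> 'a pmf \<Rightarrow> real" where
  "l1_dist p q = (\<Sum>\<^sub>\<infinity>a. \<bar>pmf p a - pmf q a\<bar>)"


section \<open>The polar transform\<close>

text \<open>Everything is indexed from \<open>0\<close>: the coordinate \<open>i < 2 ^ n\<close> of a list stands for the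
  coordinate \<open>i + 1\<close> of the vector, and \<open>take i v\<close> is the vector of the coordinates preceding it.\<close>

definition kernel_F :: "bit mat" where
  "kernel_F = mat_of_rows_list 2 [[1, 0], [1, 1]]"

definition kronecker :: "'a::times mat \<Rightarrow> 'a mat \<Rightarrow> 'a mat" where
  "kronecker A B =
     Matrix.mat (dim_row A * dim_row B) (dim_col A * dim_col B)
       (\<lambda>(i, j). A $$ (i div dim_row B, j div dim_col B) * B $$ (i mod dim_row B, j mod dim_col B))"

primrec kronecker_power :: "'a::semiring_1 mat \<Rightarrow> nat \<Rightarrow> 'a mat" where
  "kronecker_power A 0 = 1\<^sub>m 1"
| "kronecker_power A (Suc n) = kronecker A (kronecker_power A n)"

text \<open>\<open>bit_reversal n i\<close> reverses the \<open>n\<close>-digit binary expansion of \<open>i\<close>.\<close>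

definition bit_reversal :: "nat \<Rightarrow> nat \<Rightarrow> nat" where
  "bit_reversal n i = horner_sum of_bool 2 (rev (map (bit i) [0..<n]))"

definition bit_reversal_mat :: "nat \<Rightarrow> bit mat" where
  "bit_reversal_mat n = Matrix.mat (2 ^ n) (2 ^ n) (\<lambda>(i, j). of_bool (j = bit_reversal n i))"

definition polar_mat :: "nat \<Rightarrow> bit mat" where
  "polar_mat n = bit_reversal_mat n * kronecker_power kernel_F n"

text \<open>The row vector \<open>u\<close> times \<open>polar_mat n\<close>, which is why the matrix is transposed.\<close>

definition polar_transform :: "nat \<Rightarrow> bit list \<Rightarrow> bit list" where
  "polar_transform n u = list_of_vec (transpose_mat (polar_mat n) *\<^sub>v vec_of_list u)"


section \<open>The i.i.d. source\<close>

text \<open>\<open>p\<close> is the joint law of \<open>(U, X, Y)\<close>.  The functions below are the random vectors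
  obtained from \<open>2 ^ n\<close> i.i.d. copies.\<close>

definition iid :: "(bit \<times> 'x \<times> 'y) pmf \<Rightarrow> nat \<Rightarrow> (bit \<times> 'x \<times> 'y) list pmf" where
  "iid p n = replicate_pmf (2 ^ n) p"

definition U_vec :: "(bit \<times> 'x \<times> 'y) list \<Rightarrow> bit list" where
  "U_vec \<omega> = map fst \<omega>"

definition X_vec :: "(bit \<times> 'x \<times> 'y) list \<Rightarrow> 'x list" where
  "X_vec \<omega> = map (fst \<circ> snd) \<omega>"

definition Y_vec :: "(bit \<times> 'x \<times> 'y) list \<Rightarrow> 'y list" where
  "Y_vec \<omega> = map (snd \<circ> snd) \<omega>"

definition V_vec :: "nat \<Rightarrow> (bit \<times> 'x \<times> 'y) list \<Rightarrow> bit list" where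
  "V_vec n \<omega> = polar_transform n (U_vec \<omega>)"

definition source_law :: "(bit \<times> 'x \<times> 'y) pmf \<Rightarrow> nat \<Rightarrow> (bit list \<times> 'x list \<times> 'y list) pmf" where
  "source_law p n = map_pmf (\<lambda>\<omega>. (U_vec \<omega>, X_vec \<omega>, Y_vec \<omega>)) (iid p n)"


section \<open>Index sets\<close>

definition delta :: "real \<Rightarrow> nat \<Rightarrow> real" where
  "delta \<beta> n = 2 powr - (real (2 ^ n) powr \<beta>)"

definition low_U :: "(bit \<times> 'x \<times> 'y) pmf \<Rightarrow> real \<Rightarrow> nat \<Rightarrow> nat set" where
  "low_U p \<beta> n =
     {i \<in> {..<2 ^ n}. bhatt (iid p n) (\<lambda>\<omega>. V_vec n \<omega> ! i) (\<lambda>\<omega>. take i (V_vec n \<omega>)) \<le> delta \<beta> n}"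

definition high_U_given_X :: "(bit \<times> 'x \<times> 'y) pmf \<Rightarrow> real \<Rightarrow> nat \<Rightarrow> nat set" where
  "high_U_given_X p \<beta> n =
     {i \<in> {..<2 ^ n}.
        bhatt (iid p n) (\<lambda>\<omega>. V_vec n \<omega> ! i) (\<lambda>\<omega>. (take i (V_vec n \<omega>), X_vec \<omega>)) \<ge> 1 - delta \<beta> n}"

definition F_r :: "(bit \<times> 'x \<times> 'y) pmf \<Rightarrow> real \<Rightarrow> nat \<Rightarrow> nat set" where
  "F_r p \<beta> n = ({..<2 ^ n} - low_U p \<beta> n) \<inter> high_U_given_X p \<beta> n"

definition F_d :: "(bit \<times> 'x \<times> 'y) pmf \<Rightarrow> real \<Rightarrow> nat \<Rightarrow> nat set" where
  "F_d p \<beta> n = low_U p \<beta> n"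


section \<open>Encoding\<close>

text \<open>The law of coordinate \<open>i\<close> given the preceding coordinates \<open>v\<close> and the observation \<open>x\<close>.
  For \<open>i < 2 ^ n\<close> the last branch is the case \<open>i \<in> \<I>\<close>, the intersection of the complements of
  \<open>low_U p \<beta> n\<close> and \<open>high_U_given_X p \<beta> n\<close>.  The families \<open>d\<close> and \<open>e\<close> are the arbitrary
  conditional laws given null events.\<close>

definition encoder_step ::
    "(bit \<times> 'x \<times> 'y) pmf \<Rightarrow> real \<Rightarrow> (nat \<Rightarrow> nat \<Rightarrow> bit list \<Rightarrow> bit pmf) \<Rightarrow>
     (nat \<Rightarrow> nat \<Rightarrow> bit list \<times> 'x list \<Rightarrow> bit pmf) \<Rightarrow>
     nat \<Rightarrow> 'x list \<Rightarrow> nat \<Rightarrow> bit list \<Rightarrow> bit pmf" where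
  "encoder_step p \<beta> d e n x i v =
     (if i \<in> F_r p \<beta> n then pmf_of_set {0, 1}
      else if i \<in> F_d p \<beta> n then
        cond_law_or (d n i) (iid p n) (\<lambda>\<omega>. V_vec n \<omega> ! i) (\<lambda>\<omega>. take i (V_vec n \<omega>)) v
      else
        cond_law_or (e n i) (iid p n) (\<lambda>\<omega>. V_vec n \<omega> ! i)
          (\<lambda>\<omega>. (take i (V_vec n \<omega>), X_vec \<omega>)) (v, x))"

primrec generate :: "(nat \<Rightarrow> 'a list \<Rightarrow> 'a pmf) \<Rightarrow> nat \<Rightarrow> 'a list pmf" where
  "generate K 0 = return_pmf []"
| "generate K (Suc i) =
     bind_pmf (generate K i) (\<lambda>v. bind_pmf (K i v) (\<lambda>b. return_pmf (v @ [b])))"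

definition encoder_law ::
    "(bit \<times> 'x \<times> 'y) pmf \<Rightarrow> real \<Rightarrow> (nat \<Rightarrow> nat \<Rightarrow> bit list \<Rightarrow> bit pmf) \<Rightarrow>
     (nat \<Rightarrow> nat \<Rightarrow> bit list \<times> 'x list \<Rightarrow> bit pmf) \<Rightarrow>
     nat \<Rightarrow> (bit list \<times> 'x list \<times> 'y list) pmf" where
  "encoder_law p \<beta> d e n =
     bind_pmf (replicate_pmf (2 ^ n) (map_pmf snd p)) (\<lambda>xy.
     bind_pmf (generate (encoder_step p \<beta> d e n (map fst xy)) (2 ^ n)) (\<lambda>v.
     return_pmf (polar_transform n v, map fst xy, map snd xy)))"

end

(* The polar transform is an involution, and by the Markov property both laws arise from those of
   (V, X) by one and the same kernel, so it suffices to compare the laws of (V, X).  A hybrid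
   argument bounds their distance by the sum over the coordinates i of the expected distance of the
   encoder's i-th conditional law from the true one.  This term is zero for i in I, and at most
   2 sqrt(delta_N) for i in F_r (Cauchy-Schwarz) and for i in F_d, so the total is at most
   2 N sqrt(delta_N). *)

theory Submission
  imports Defs "HOL-Real_Asymp.Real_Asymp"
begin

section \<open>The distance of finitely supported laws\<close>

text \<open>The hybrid argument averages the error of each coordinate under the source law, not
  under the encoder's. This matters twice: the Bhattacharyya parameters are averages under the
  source law, and that law gives no weight to null events, where \<open>cond_law\<close> is
  unspecified and the families \<open>d\<close> and \<open>e\<close> are arbitrary. Hence equality
  with a conditional law, and finiteness of its support, are claimed on supports only. For i in F_d
  the encoder ignores X although the true conditional law does not. The two laws stay close because
  a small Z means that the past alone nearly determines the bit: the guess of the likelier value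
  fails with probability at most Z/2, and averaging over X leaves this probability unchanged. For i
  in F_r a value of Z near 1 forces a nearly uniform bit, by a pointwise identity between the
  squared distance from uniform and the term averaged in Z. The factor N and the square root, which
  halves the exponent N^\<beta>, are absorbed by \<open>\<beta>\<^sub>1\<close> < \<beta>.\<close>

lemma l1_dist_eq_sum:
  assumes "finite A" and "set_pmf p \<subseteq> A" and "set_pmf q \<subseteq> A"
  shows "l1_dist p q = (\<Sum>a\<in>A. \<bar>pmf p a - pmf q a\<bar>)"
proof -
  have "l1_dist p q = (\<Sum>\<^sub>\<infinity>a\<in>A. \<bar>pmf p a - pmf q a\<bar>)"
    unfolding l1_dist_def
  proof (rule infsum_cong_neutral)
    fix a assume "a \<in> UNIV - A"
    then have "a \<notin> set_pmf p" "a \<notin> set_pmf q" using assms by auto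
    then show "\<bar>pmf p a - pmf q a\<bar> = 0" by (simp add: set_pmf_iff)
  qed auto
  then show ?thesis using assms(1) by simp
qed

lemma l1_dist_nonneg: "0 \<le> l1_dist p q"
  unfolding l1_dist_def by (rule infsum_nonneg) simp

lemma l1_dist_self [simp]: "l1_dist p p = 0"
  unfolding l1_dist_def by simp

lemma pmf_bind_eq_sum:
  assumes "finite A" and "set_pmf p \<subseteq> A"
  shows "pmf (bind_pmf p K) b = (\<Sum>a\<in>A. pmf p a * pmf (K a) b)"
  unfolding pmf_bind
  by (subst integral_measure_pmf_real[where A = A]) (use assms in \<open>auto simp: mult.commute\<close>)

text \<open>Split pK - qL = (p - q)K + q(K - L); each \<open>K a\<close> has total mass 1, so the
  first part contributes the distance of \<open>p\<close> and \<open>q\<close>. In the hybrid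
  argument \<open>q\<close> is the true law and \<open>L\<close> a conditional law, which is
  unspecified at null values; so \<open>L\<close> is constrained on the support of \<open>q\<close>
  only.\<close>

lemma l1_dist_bind_le:
  assumes p: "finite (set_pmf p)" and q: "finite (set_pmf q)"
    and K: "\<And>a. a \<in> set_pmf p \<union> set_pmf q \<Longrightarrow> finite (set_pmf (K a))"
    and L: "\<And>a. a \<in> set_pmf q \<Longrightarrow> finite (set_pmf (L a))"
  shows "l1_dist (bind_pmf p K) (bind_pmf q L)
           \<le> l1_dist p q + measure_pmf.expectation q (\<lambda>a. l1_dist (K a) (L a))"
proof -
  define A where "A = set_pmf p \<union> set_pmf q"
  define B where "B = (\<Union>a\<in>A. set_pmf (K a)) \<union> (\<Union>a\<in>set_pmf q. set_pmf (L a))"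
  have A: "finite A" "set_pmf p \<subseteq> A" "set_pmf q \<subseteq> A" using p q by (auto simp: A_def)
  have B: "finite B" using A K L q by (auto simp: B_def A_def)
  have "l1_dist (bind_pmf p K) (bind_pmf q L)
      = (\<Sum>b\<in>B. \<bar>pmf (bind_pmf p K) b - pmf (bind_pmf q L) b\<bar>)"
    by (rule l1_dist_eq_sum[OF B]) (use A in \<open>auto simp: B_def\<close>)
  also have "\<dots> \<le> (\<Sum>b\<in>B. \<Sum>a\<in>A. \<bar>pmf p a - pmf q a\<bar> * pmf (K a) b
                    + pmf q a * \<bar>pmf (K a) b - pmf (L a) b\<bar>)"
  proof (rule sum_mono)
    fix b
    have "\<bar>pmf (bind_pmf p K) b - pmf (bind_pmf q L) b\<bar>
        = \<bar>\<Sum>a\<in>A. pmf p a * pmf (K a) b - pmf q a * pmf (L a) b\<bar>"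
      by (simp add: pmf_bind_eq_sum[OF A(1,2)] pmf_bind_eq_sum[OF A(1,3)] sum_subtractf)
    also have "\<dots> \<le> (\<Sum>a\<in>A. \<bar>pmf p a * pmf (K a) b - pmf q a * pmf (L a) b\<bar>)"
      by (rule sum_abs)
    also have "\<dots> \<le> (\<Sum>a\<in>A. \<bar>pmf p a - pmf q a\<bar> * pmf (K a) b
                    + pmf q a * \<bar>pmf (K a) b - pmf (L a) b\<bar>)"
    proof (rule sum_mono)
      fix a
      have "\<bar>pmf p a * pmf (K a) b - pmf q a * pmf (L a) b\<bar>
          = \<bar>(pmf p a - pmf q a) * pmf (K a) b + pmf q a * (pmf (K a) b - pmf (L a) b)\<bar>"
        by (simp add: algebra_simps)
      also have "\<dots> \<le> \<bar>pmf p a - pmf q a\<bar> * pmf (K a) b + pmf q a * \<bar>pmf (K a) b - pmf (L a) b\<bar>"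
        by (rule order_trans[OF abs_triangle_ineq]) (simp add: abs_mult)
      finally show "\<bar>pmf p a * pmf (K a) b - pmf q a * pmf (L a) b\<bar> \<le> \<dots>" .
    qed
    finally show "\<bar>pmf (bind_pmf p K) b - pmf (bind_pmf q L) b\<bar> \<le> \<dots>" .
  qed
  also have "\<dots> = (\<Sum>a\<in>A. \<bar>pmf p a - pmf q a\<bar> * (\<Sum>b\<in>B. pmf (K a) b)
                    + pmf q a * (\<Sum>b\<in>B. \<bar>pmf (K a) b - pmf (L a) b\<bar>))"
    by (subst sum.swap) (simp add: sum.distrib sum_distrib_left)
  also have "\<dots> = (\<Sum>a\<in>A. \<bar>pmf p a - pmf q a\<bar> + pmf q a * l1_dist (K a) (L a))"
  proof (rule sum.cong)
    fix a assume a: "a \<in> A"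
    have "(\<Sum>b\<in>B. pmf (K a) b) = 1"
      by (rule sum_pmf_eq_1[OF B]) (use a in \<open>auto simp: B_def\<close>)
    moreover have "(\<Sum>b\<in>B. \<bar>pmf (K a) b - pmf (L a) b\<bar>) = l1_dist (K a) (L a)"
      if "a \<in> set_pmf q"
      by (rule l1_dist_eq_sum[symmetric, OF B]) (use that in \<open>auto simp: B_def A_def\<close>)
    ultimately show "\<bar>pmf p a - pmf q a\<bar> * (\<Sum>b\<in>B. pmf (K a) b)
          + pmf q a * (\<Sum>b\<in>B. \<bar>pmf (K a) b - pmf (L a) b\<bar>)
        = \<bar>pmf p a - pmf q a\<bar> + pmf q a * l1_dist (K a) (L a)"
      by (cases "a \<in> set_pmf q") (simp_all add: set_pmf_iff)
  qed simp
  also have "\<dots> = l1_dist p q + (\<Sum>a\<in>A. l1_dist (K a) (L a) * pmf q a)"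
    by (simp add: l1_dist_eq_sum[OF A] sum.distrib mult.commute)
  also have "(\<Sum>a\<in>A. l1_dist (K a) (L a) * pmf q a)
      = measure_pmf.expectation q (\<lambda>a. l1_dist (K a) (L a))"
    by (rule integral_measure_pmf_real[symmetric]) (use A in auto)
  finally show ?thesis .
qed

text \<open>Data processing inequality.\<close>

corollary l1_dist_bind_same_le:
  assumes "finite (set_pmf p)" and "finite (set_pmf q)"
    and "\<And>a. a \<in> set_pmf p \<union> set_pmf q \<Longrightarrow> finite (set_pmf (K a))"
  shows "l1_dist (bind_pmf p K) (bind_pmf q K) \<le> l1_dist p q"
  using l1_dist_bind_le[of p q K K] assms by simp

section \<open>Conditional laws\<close>

text \<open>Disintegration along \<open>T\<close>. The unspecified values of \<open>cond_law\<close>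
  at null \<open>t\<close> do no harm, since the bind weights them by zero.\<close>

lemma map_pmf_eq_bind_cond_law:
  "map_pmf (\<lambda>\<omega>. (S \<omega>, T \<omega>)) M
     = bind_pmf (map_pmf T M) (\<lambda>t. map_pmf (\<lambda>s. (s, t)) (cond_law M S T t))"
proof -
  have "bind_pmf (map_pmf T M) (\<lambda>t. cond_pmf M {\<omega>. T \<omega> = t}) = M"
  proof (rule bind_cond_pmf_cancel[where R = "\<lambda>t \<omega>. T \<omega> = t"])
    fix t \<omega> assume "T \<omega> = t"
    then show "measure_pmf.prob M {\<omega>. T \<omega> = t} = measure_pmf.prob (map_pmf T M) {x. T \<omega> = x}"
      by (auto simp: vimage_def)
  qed auto
  then have "map_pmf (\<lambda>\<omega>. (S \<omega>, T \<omega>)) M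
      = map_pmf (\<lambda>\<omega>. (S \<omega>, T \<omega>)) (bind_pmf (map_pmf T M) (\<lambda>t. cond_pmf M {\<omega>. T \<omega> = t}))"
    by simp
  also have "\<dots> = bind_pmf (map_pmf T M)
      (\<lambda>t. map_pmf (\<lambda>\<omega>. (S \<omega>, T \<omega>)) (cond_pmf M {\<omega>. T \<omega> = t}))"
    by (rule map_bind_pmf)
  also have "\<dots> = bind_pmf (map_pmf T M) (\<lambda>t. map_pmf (\<lambda>s. (s, t)) (cond_law M S T t))"
  proof (rule bind_pmf_cong)
    fix t assume "t \<in> set_pmf (map_pmf T M)"
    then have "set_pmf M \<inter> {\<omega>. T \<omega> = t} \<noteq> {}" by auto
    then show "map_pmf (\<lambda>\<omega>. (S \<omega>, T \<omega>)) (cond_pmf M {\<omega>. T \<omega> = t})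
        = map_pmf (\<lambda>s. (s, t)) (cond_law M S T t)"
      unfolding cond_law_def map_pmf_comp
      by (intro map_pmf_cong refl) auto
  qed simp
  finally show ?thesis .
qed

text \<open>Both sides are the probability that the guess \<open>c\<close> of \<open>S\<close> from
  \<open>T\<close> is right. If the guess uses only part of \<open>T\<close>, conditioning on that
  part or on all of \<open>T\<close> therefore gives the same expectation.\<close>

lemma expectation_pmf_cond_law:
  "measure_pmf.expectation (map_pmf T M) (\<lambda>t. pmf (cond_law M S T t) (c t))
     = measure_pmf.prob M {\<omega>. S \<omega> = c (T \<omega>)}"
proof -
  have "measure_pmf.prob M {\<omega>. S \<omega> = c (T \<omega>)}
      = pmf (map_pmf (\<lambda>(s, t). s = c t) (map_pmf (\<lambda>\<omega>. (S \<omega>, T \<omega>)) M)) True"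
    by (simp add: pmf_map map_pmf_comp vimage_def)
  also have "\<dots> = pmf (bind_pmf (map_pmf T M)
      (\<lambda>t. map_pmf (\<lambda>s. s = c t) (cond_law M S T t))) True"
    unfolding map_pmf_eq_bind_cond_law[of S T M] by (simp add: map_bind_pmf map_pmf_comp)
  also have "\<dots> = measure_pmf.expectation (map_pmf T M) (\<lambda>t. pmf (cond_law M S T t) (c t))"
    unfolding pmf_bind by (simp add: pmf_map vimage_def measure_pmf_single)
  finally show ?thesis ..
qed

section \<open>Bhattacharyya bounds\<close>

lemma UNIV_bit_eq: "(UNIV :: bit set) = {0, 1}"
  using bit.exhaust by auto

lemma finite_bit_set [simp]: "finite (A :: bit set)"
  by (rule finite_subset[OF subset_UNIV]) (simp add: UNIV_bit_eq)

lemma pmf_bit_sum: "pmf p 0 + pmf p (1 :: bit) = 1"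
proof -
  have "(\<Sum>b\<in>UNIV. pmf p b) = 1" by (rule sum_pmf_eq_1) simp_all
  then show ?thesis by (simp add: UNIV_bit_eq)
qed

lemma l1_dist_bit:
  fixes p q :: "bit pmf"
  shows "l1_dist p q = 2 * \<bar>pmf p c - pmf q c\<bar>"
proof -
  have "l1_dist p q = (\<Sum>b\<in>UNIV. \<bar>pmf p b - pmf q b\<bar>)"
    by (rule l1_dist_eq_sum) simp_all
  then have "l1_dist p q = \<bar>pmf p 0 - pmf q 0\<bar> + \<bar>pmf p 1 - pmf q 1\<bar>"
    by (simp add: UNIV_bit_eq)
  then show ?thesis
    using pmf_bit_sum[of p] pmf_bit_sum[of q] by (cases c) auto
qed

lemma l1_dist_bit_le:
  fixes p q :: "bit pmf"
  shows "l1_dist p q \<le> 2 * (pmf p c + pmf q c)"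
  unfolding l1_dist_bit[of p q c] by (auto simp: abs_if)

lemma bhatt_eq_expectation:
  assumes "finite (set_pmf M)"
  shows "bhatt M T V = measure_pmf.expectation (map_pmf V M)
           (\<lambda>v. 2 * sqrt (pmf (cond_law M T V v) 0 * pmf (cond_law M T V v) 1))"
proof -
  have "measure_pmf.expectation (map_pmf V M)
           (\<lambda>v. 2 * sqrt (pmf (cond_law M T V v) 0 * pmf (cond_law M T V v) 1))
      = (\<Sum>v\<in>set_pmf (map_pmf V M).
           2 * sqrt (pmf (cond_law M T V v) 0 * pmf (cond_law M T V v) 1) * pmf (map_pmf V M) v)"
    by (rule integral_measure_pmf_real) (use assms in auto)
  also have "\<dots> = bhatt M T V"
    unfolding bhatt_def using assms by (simp add: sum_distrib_left ac_simps)
  finally show ?thesis ..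
qed

text \<open>With \<open>c v\<close> the less likely value of \<open>T\<close> given \<open>V = v\<close>, the distance of the two conditional
  laws is at most twice the sum of their masses at \<open>c v\<close>, and both masses have expectation
  \<open>P (T = c V)\<close>, which is at most \<open>Z(T|V) / 2\<close>.\<close>

lemma expectation_l1_dist_refinement_le_bhatt:
  assumes M: "finite (set_pmf M)"
  shows "measure_pmf.expectation (map_pmf (\<lambda>\<omega>. (V \<omega>, X \<omega>)) M)
           (\<lambda>w. l1_dist (cond_law M T V (fst w)) (cond_law M T (\<lambda>\<omega>. (V \<omega>, X \<omega>)) w))
         \<le> 2 * bhatt M T V"
proof -
  let ?W = "\<lambda>\<omega>. (V \<omega>, X \<omega>)"
  define c :: "_ \<Rightarrow> bit" where
    "c v = (if pmf (cond_law M T V v) 0 \<le> pmf (cond_law M T V v) 1 then 0 else 1)" for v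
  have int: "integrable (map_pmf f M) g" for f :: "'a \<Rightarrow> 'z" and g :: "'z \<Rightarrow> real"
    by (rule integrable_measure_pmf_finite) (use M in simp)
  have V: "map_pmf V M = map_pmf fst (map_pmf ?W M)" by (simp add: map_pmf_comp)
  have "measure_pmf.expectation (map_pmf ?W M)
           (\<lambda>w. l1_dist (cond_law M T V (fst w)) (cond_law M T ?W w))
      \<le> measure_pmf.expectation (map_pmf ?W M)
           (\<lambda>w. 2 * (pmf (cond_law M T V (fst w)) (c (fst w)) + pmf (cond_law M T ?W w) (c (fst w))))"
    by (intro integral_mono int l1_dist_bit_le)
  also have "\<dots> = 2 * (measure_pmf.expectation (map_pmf V M) (\<lambda>v. pmf (cond_law M T V v) (c v))
        + measure_pmf.expectation (map_pmf ?W M) (\<lambda>w. pmf (cond_law M T ?W w) (c (fst w))))"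
    unfolding V integral_map_pmf by (simp add: distrib_left integrable_measure_pmf_finite[OF M])
  also have "measure_pmf.expectation (map_pmf ?W M) (\<lambda>w. pmf (cond_law M T ?W w) (c (fst w)))
      = measure_pmf.expectation (map_pmf V M) (\<lambda>v. pmf (cond_law M T V v) (c v))"
    unfolding expectation_pmf_cond_law by simp
  also have "2 * (measure_pmf.expectation (map_pmf V M) (\<lambda>v. pmf (cond_law M T V v) (c v))
        + measure_pmf.expectation (map_pmf V M) (\<lambda>v. pmf (cond_law M T V v) (c v)))
      = 2 * measure_pmf.expectation (map_pmf V M) (\<lambda>v. 2 * pmf (cond_law M T V v) (c v))"
    by simp
  also have "\<dots> \<le> 2 * bhatt M T V"
    unfolding bhatt_eq_expectation[OF M]
  proof (rule mult_left_mono[OF integral_mono[OF int int]])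
    fix v
    let ?a = "pmf (cond_law M T V v) 0" and ?b = "pmf (cond_law M T V v) 1"
    have "pmf (cond_law M T V v) (c v) = sqrt (min ?a ?b * min ?a ?b)"
      by (auto simp: c_def min_def)
    also have "\<dots> \<le> sqrt (?a * ?b)"
      by (intro real_sqrt_le_mono mult_mono) auto
    finally show "2 * pmf (cond_law M T V v) (c v) \<le> 2 * sqrt (?a * ?b)" by simp
  qed simp
  finally show ?thesis .
qed

text \<open>If q is the conditional mass at 0, the distance from uniform is |1 - 2q|, and (1 - 2q)^2
  = 1 - 4q(1 - q) = 1 - z^2 with z the term averaged in \<open>bhatt\<close>. Jensen's inequality
  for the square, applied to the distance and to z, gives the bound.\<close>

lemma expectation_l1_dist_uniform_le_bhatt:
  assumes M: "finite (set_pmf M)"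
  shows "measure_pmf.expectation (map_pmf V M) (\<lambda>v. l1_dist (pmf_of_set {0, 1}) (cond_law M T V v))
         \<le> sqrt (1 - (bhatt M T V)\<^sup>2)"
proof -
  let ?E = "measure_pmf.expectation (map_pmf V M)"
  let ?f = "\<lambda>v. l1_dist (pmf_of_set {0, 1}) (cond_law M T V v)"
  let ?z = "\<lambda>v. 2 * sqrt (pmf (cond_law M T V v) 0 * pmf (cond_law M T V v) 1)"
  have int: "integrable (map_pmf V M) g" for g :: "_ \<Rightarrow> real"
    by (rule integrable_measure_pmf_finite) (use M in simp)
  have square: "(?E g)\<^sup>2 \<le> ?E (\<lambda>v. (g v)\<^sup>2)" for g :: "_ \<Rightarrow> real"
  proof -
    \<comment> \<open>The variance of \<open>g\<close> is nonnegative.\<close>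
    have "0 \<le> ?E (\<lambda>v. (g v - ?E g)\<^sup>2)"
      by (rule Bochner_Integration.integral_nonneg) simp
    then show ?thesis by (subst (asm) measure_pmf.variance_eq[OF int int]) simp
  qed
  have f: "(?f v)\<^sup>2 = 1 - (?z v)\<^sup>2" for v
  proof -
    let ?q = "pmf (cond_law M T V v) 0"
    have "(?f v)\<^sup>2 = (1 - 2 * ?q)\<^sup>2"
      by (simp add: l1_dist_bit[of _ _ 0] power2_eq_square algebra_simps)
    also have "\<dots> = 1 - 4 * (?q * (1 - ?q))" by (simp add: power2_eq_square algebra_simps)
    also have "1 - ?q = pmf (cond_law M T V v) 1" using pmf_bit_sum[of "cond_law M T V v"] by simp
    finally show ?thesis by (simp add: power_mult_distrib)
  qed
  have "(?E ?f)\<^sup>2 \<le> ?E (\<lambda>v. (?f v)\<^sup>2)" by (rule square)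
  also have "\<dots> = 1 - ?E (\<lambda>v. (?z v)\<^sup>2)"
    unfolding f by (subst Bochner_Integration.integral_diff[OF int int]) simp
  also have "\<dots> \<le> 1 - (bhatt M T V)\<^sup>2"
    using square[of ?z] by (simp add: bhatt_eq_expectation[OF M])
  finally show ?thesis by (rule real_le_rsqrt)
qed

section \<open>Successive generation\<close>

lemma finite_set_pmf_generate:
  assumes "\<And>i v. finite (set_pmf (K i v))"
  shows "finite (set_pmf (generate K i))"
  using assms by (induction i) auto

text \<open>Telescoping over the coordinates: both laws of i + 1 coordinates arise from those of i
  coordinates by appending one bit, so \<open>l1_dist_bind_le\<close> passes on the old distance and
  adds the new error, averaged under the true law.\<close>

lemma l1_dist_generate_le:
  fixes V :: "'w \<Rightarrow> 'a list" and X :: "'w \<Rightarrow> 'x"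
  assumes M: "finite (set_pmf M)" and K: "\<And>x j v. finite (set_pmf (K x j v))"
    and "\<And>\<omega>. i \<le> length (V \<omega>)"
  shows "l1_dist (bind_pmf (map_pmf X M) (\<lambda>x. map_pmf (\<lambda>v. (v, x)) (generate (K x) i)))
             (map_pmf (\<lambda>\<omega>. (take i (V \<omega>), X \<omega>)) M)
         \<le> (\<Sum>j<i. measure_pmf.expectation (map_pmf (\<lambda>\<omega>. (take j (V \<omega>), X \<omega>)) M)
               (\<lambda>w. l1_dist (K (snd w) j (fst w))
                       (cond_law M (\<lambda>\<omega>. V \<omega> ! j) (\<lambda>\<omega>. (take j (V \<omega>), X \<omega>)) w)))"
  using assms(3)
proof (induction i)
  case 0
  have "bind_pmf (map_pmf X M) (\<lambda>x. map_pmf (\<lambda>v. (v, x)) (generate (K x) 0))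
      = map_pmf (\<lambda>\<omega>. (take 0 (V \<omega>), X \<omega>)) M"
    by (simp add: bind_assoc_pmf map_pmf_def bind_return_pmf)
  then show ?case by simp
next
  case (Suc i)
  let ?J = "\<lambda>i. bind_pmf (map_pmf X M) (\<lambda>x. map_pmf (\<lambda>v. (v, x)) (generate (K x) i))"
  let ?W = "\<lambda>i \<omega>. (take i (V \<omega>), X \<omega>)"
  let ?C = "cond_law M (\<lambda>\<omega>. V \<omega> ! i) (?W i)"
  let ?append = "\<lambda>w b. (fst w @ [b], snd w)"
  have J: "?J (Suc i)
      = bind_pmf (?J i) (\<lambda>w. map_pmf (?append w) (K (snd w) i (fst w)))"
    by (simp add: bind_assoc_pmf bind_map_pmf map_bind_pmf map_pmf_def bind_return_pmf)
  have "map_pmf (?W (Suc i)) M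
      = map_pmf (\<lambda>(b, w). ?append w b) (map_pmf (\<lambda>\<omega>. (V \<omega> ! i, ?W i \<omega>)) M)"
    unfolding map_pmf_comp
    by (intro map_pmf_cong refl) (use Suc.prems in \<open>simp add: take_Suc_conv_app_nth Suc_le_eq\<close>)
  also have "\<dots> = bind_pmf (map_pmf (?W i) M) (\<lambda>w. map_pmf (?append w) (?C w))"
    unfolding map_pmf_eq_bind_cond_law[of "\<lambda>\<omega>. V \<omega> ! i" "?W i" M] by (simp add: map_bind_pmf map_pmf_comp)
  finally have W: "map_pmf (?W (Suc i)) M = \<dots>" .
  have C: "finite (set_pmf (?C w))" if "w \<in> set_pmf (map_pmf (?W i) M)" for w
  proof -
    have "set_pmf M \<inter> {\<omega>. ?W i \<omega> = w} \<noteq> {}" using that by auto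
    then show ?thesis unfolding cond_law_def using M by simp
  qed
  \<comment> \<open>Appending is a deterministic map, so data processing applies; the restriction to
    the support makes \<open>?C w\<close> a genuine conditional law.\<close>
  have append: "l1_dist (map_pmf (?append w) (K (snd w) i (fst w))) (map_pmf (?append w) (?C w))
      \<le> l1_dist (K (snd w) i (fst w)) (?C w)" if "w \<in> set_pmf (map_pmf (?W i) M)" for w
    unfolding map_pmf_def by (rule l1_dist_bind_same_le[OF K C[OF that]]) simp
  have "l1_dist (?J (Suc i)) (map_pmf (?W (Suc i)) M)
      \<le> l1_dist (?J i) (map_pmf (?W i) M)
        + measure_pmf.expectation (map_pmf (?W i) M)
            (\<lambda>w. l1_dist (map_pmf (?append w) (K (snd w) i (fst w))) (map_pmf (?append w) (?C w)))"
    unfolding J W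
    by (rule l1_dist_bind_le) (use M K C finite_set_pmf_generate[of "K _"] in auto)
  also have "measure_pmf.expectation (map_pmf (?W i) M)
            (\<lambda>w. l1_dist (map_pmf (?append w) (K (snd w) i (fst w))) (map_pmf (?append w) (?C w)))
      \<le> measure_pmf.expectation (map_pmf (?W i) M) (\<lambda>w. l1_dist (K (snd w) i (fst w)) (?C w))"
    by (intro integral_mono_AE integrable_measure_pmf_finite)
      (use M append in \<open>auto simp: AE_measure_pmf_iff\<close>)
  finally have step: "l1_dist (?J (Suc i)) (map_pmf (?W (Suc i)) M)
      \<le> l1_dist (?J i) (map_pmf (?W i) M)
        + measure_pmf.expectation (map_pmf (?W i) M) (\<lambda>w. l1_dist (K (snd w) i (fst w)) (?C w))"
    by simp
  have "\<And>\<omega>. i \<le> length (V \<omega>)" using Suc.prems Suc_leD by blast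
  from step Suc.IH[OF this] show ?case by simp
qed

section \<open>Product kernels\<close>

text \<open>The memoryless channel with transition law \<open>W\<close>, acting on input
  words.\<close>

primrec product_kernel :: "('x \<Rightarrow> 'y pmf) \<Rightarrow> 'x list \<Rightarrow> 'y list pmf" where
  "product_kernel W [] = return_pmf []"
| "product_kernel W (x # xs) =
     bind_pmf (W x) (\<lambda>y. bind_pmf (product_kernel W xs) (\<lambda>ys. return_pmf (y # ys)))"

lemma length_product_kernel:
  "ys \<in> set_pmf (product_kernel W xs) \<Longrightarrow> length ys = length xs"
  by (induction xs arbitrary: ys) auto

lemma finite_set_pmf_product_kernel:
  assumes "\<And>x. x \<in> set xs \<Longrightarrow> finite (set_pmf (W x))"
  shows "finite (set_pmf (product_kernel W xs))"
  using assms by (induction xs) auto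

lemma map_replicate_pmf: "map_pmf (map f) (replicate_pmf m p) = replicate_pmf m (map_pmf f p)"
proof (induction m)
  case (Suc m)
  show ?case by (simp add: map_bind_pmf bind_map_pmf flip: Suc.IH)
qed simp

text \<open>Independent input-output pairs may be drawn by choosing all inputs before any output.
  \<open>g\<close> selects what the channel sees and \<open>h\<close> assembles the result: this
  serves both for X alone and for (U, X), where the channel sees only X.\<close>

lemma replicate_pmf_bind_kernel:
  "replicate_pmf m (bind_pmf q (\<lambda>a. map_pmf (h a) (W (g a))))
     = bind_pmf (replicate_pmf m q) (\<lambda>as. map_pmf (map2 h as) (product_kernel W (map g as)))"
proof (induction m)
  case 0
  show ?case by (simp add: bind_return_pmf)
next
  case (Suc m)
  have "replicate_pmf (Suc m) (bind_pmf q (\<lambda>a. map_pmf (h a) (W (g a))))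
      = bind_pmf q (\<lambda>a. bind_pmf (W (g a)) (\<lambda>y. bind_pmf (replicate_pmf m q) (\<lambda>as.
          bind_pmf (product_kernel W (map g as)) (\<lambda>ys. return_pmf (h a y # map2 h as ys)))))"
    unfolding replicate_pmf.simps Suc.IH by (simp add: map_pmf_def bind_assoc_pmf bind_return_pmf)
  \<comment> \<open>The first output is independent of the remaining inputs, so the two draws
    commute.\<close>
  also have "\<dots> = bind_pmf q (\<lambda>a. bind_pmf (replicate_pmf m q) (\<lambda>as. bind_pmf (W (g a)) (\<lambda>y.
          bind_pmf (product_kernel W (map g as)) (\<lambda>ys. return_pmf (h a y # map2 h as ys)))))"
    by (intro bind_pmf_cong refl bind_commute_pmf)
  also have "\<dots> = bind_pmf (replicate_pmf (Suc m) q)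
      (\<lambda>as. map_pmf (map2 h as) (product_kernel W (map g as)))"
    by (simp add: map_pmf_def bind_assoc_pmf bind_return_pmf)
  finally show ?case .
qed

section \<open>The polar transform is an involution\<close>

lemma kronecker_carrier:
  "A \<in> carrier_mat a b \<Longrightarrow> B \<in> carrier_mat c d \<Longrightarrow> kronecker A B \<in> carrier_mat (a * c) (b * d)"
  by (auto simp: kronecker_def)

lemma kronecker_power_carrier:
  "A \<in> carrier_mat a b \<Longrightarrow> kronecker_power A n \<in> carrier_mat (a ^ n) (b ^ n)"
  by (induction n) (auto intro: kronecker_carrier)

lemma mod_less_if_less_mult: "k < a * b \<Longrightarrow> k mod b < (b :: nat)"
  by (cases "b = 0") auto

lemma mult_add_less_mult:
  assumes "i < a" and "j < (b :: nat)"
  shows "i * b + j < a * b"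
proof -
  have "i * b + j < Suc i * b" using assms(2) by simp
  also have "\<dots> \<le> a * b" using assms(1) by (intro mult_le_mono1) simp
  finally show ?thesis .
qed

lemma sum_div_mod:
  fixes f :: "nat \<Rightarrow> nat \<Rightarrow> 'a::comm_monoid_add"
  shows "(\<Sum>k<a * b. f (k div b) (k mod b)) = (\<Sum>i<a. \<Sum>j<b. f i j)"
proof -
  have "(\<Sum>i<a. \<Sum>j<b. f i j) = (\<Sum>(i, j)\<in>{..<a} \<times> {..<b}. f i j)"
    by (simp add: sum.cartesian_product)
  also have "\<dots> = (\<Sum>k<a * b. f (k div b) (k mod b))"
    by (rule sum.reindex_bij_witness[where i = "\<lambda>k. (k div b, k mod b)" and j = "\<lambda>(i, j). i * b + j"])
      (auto simp: less_mult_imp_div_less mult_add_less_mult mod_less_if_less_mult)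
  finally show ?thesis ..
qed

text \<open>Splitting the inner summation index into quotient and remainder modulo \<open>d\<close>
  turns the matrix product sum into a product of two sums.\<close>

lemma kronecker_mult:
  fixes A B C D :: "'a::comm_semiring_0 mat"
  assumes A: "A \<in> carrier_mat a b" and B: "B \<in> carrier_mat c d"
    and C: "C \<in> carrier_mat b e" and D: "D \<in> carrier_mat d f"
  shows "kronecker A B * kronecker C D = kronecker (A * C) (B * D)"
proof (rule eq_matI)
  fix i j
  assume ij: "i < dim_row (kronecker (A * C) (B * D))" "j < dim_col (kronecker (A * C) (B * D))"
  then have i: "i < a * c" "i div c < a" "i mod c < c" and j: "j < e * f" "j div f < e" "j mod f < f"
    using A B C D by (auto simp: kronecker_def less_mult_imp_div_less mod_less_if_less_mult)
  have kd: "k div d < b" "k mod d < d" if "k < b * d" for k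
    using that by (auto simp: less_mult_imp_div_less mod_less_if_less_mult)
  have "(kronecker A B * kronecker C D) $$ (i, j)
      = (\<Sum>k<b * d. (A $$ (i div c, k div d) * B $$ (i mod c, k mod d))
                   * (C $$ (k div d, j div f) * D $$ (k mod d, j mod f)))"
    using i j A B C D by (auto simp: kronecker_def scalar_prod_def atLeast0LessThan)
  also have "\<dots> = (\<Sum>k<b. \<Sum>l<d. (A $$ (i div c, k) * B $$ (i mod c, l))
                   * (C $$ (k, j div f) * D $$ (l, j mod f)))"
    by (rule sum_div_mod)
  also have "\<dots> = (\<Sum>k<b. A $$ (i div c, k) * C $$ (k, j div f))
      * (\<Sum>l<d. B $$ (i mod c, l) * D $$ (l, j mod f))"
    by (simp add: sum_product ac_simps)
  also have "\<dots> = kronecker (A * C) (B * D) $$ (i, j)"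
    using i j A B C D by (auto simp: kronecker_def scalar_prod_def atLeast0LessThan)
  finally show "(kronecker A B * kronecker C D) $$ (i, j) = kronecker (A * C) (B * D) $$ (i, j)" .
qed (use A B C D in \<open>auto simp: kronecker_def\<close>)

lemma kronecker_one: "kronecker (1\<^sub>m a) (1\<^sub>m b) = (1\<^sub>m (a * b) :: 'a::semiring_1 mat)"
proof (rule eq_matI)
  fix i j assume "i < dim_row (1\<^sub>m (a * b) :: 'a mat)" "j < dim_col (1\<^sub>m (a * b) :: 'a mat)"
  then have *: "i < a * b" "i div b < a" "i mod b < b" "j < a * b" "j div b < a" "j mod b < b"
    by (auto simp: less_mult_imp_div_less mod_less_if_less_mult)
  moreover have "i = j" if "i div b = j div b" "i mod b = j mod b"
    using that by (metis div_mult_mod_eq)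
  ultimately show "kronecker (1\<^sub>m a) (1\<^sub>m b) $$ (i, j) = (1\<^sub>m (a * b) :: 'a mat) $$ (i, j)"
    by (auto simp: kronecker_def)
qed (auto simp: kronecker_def)

section \<open>The kernel F and its Kronecker powers\<close>

lemma kernel_F_carrier: "kernel_F \<in> carrier_mat 2 2"
  by (rule carrier_matI) (simp_all add: kernel_F_def mat_of_rows_list_def)

lemma kernel_F_entry: "i < 2 \<Longrightarrow> j < 2 \<Longrightarrow> kernel_F $$ (i, j) = of_bool (j \<le> i)"
  by (auto simp: kernel_F_def mat_of_rows_list_def less_2_cases_iff)

lemma kernel_F_square: "kernel_F * kernel_F = 1\<^sub>m 2"
  by (rule eq_matI)
    (use kernel_F_carrier in \<open>auto simp: scalar_prod_def kernel_F_entry numeral_2_eq_2 less_Suc_eq\<close>)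

lemma kronecker_power_kernel_F_square:
  "kronecker_power kernel_F n * kronecker_power kernel_F n = 1\<^sub>m (2 ^ n)"
proof (induction n)
  case (Suc n)
  have K: "kronecker_power kernel_F n \<in> carrier_mat (2 ^ n) (2 ^ n)"
    by (rule kronecker_power_carrier[OF kernel_F_carrier])
  show ?case
    using kronecker_mult[OF kernel_F_carrier K kernel_F_carrier K]
    by (simp add: Suc.IH kernel_F_square kronecker_one)
qed simp

text \<open>The leading digit comes from F, the lower digits from the smaller power; the result is
  the Sierpinski pattern, binomial(i, j) mod 2. Its use is that the condition treats all digit
  positions alike, so reversing the digits of both indices preserves the entry.\<close>

lemma kronecker_power_kernel_F_entry:
  "i < 2 ^ n \<Longrightarrow> j < 2 ^ n \<Longrightarrow>
     kronecker_power kernel_F n $$ (i, j) = of_bool (\<forall>k<n. bit j k \<longrightarrow> bit i k)"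
proof (induction n arbitrary: i j)
  case (Suc n)
  have K: "kronecker_power kernel_F n \<in> carrier_mat (2 ^ n) (2 ^ n)"
    by (rule kronecker_power_carrier[OF kernel_F_carrier])
  have ij: "i div 2 ^ n < 2" "j div 2 ^ n < 2"
    using Suc.prems by (simp_all add: less_mult_imp_div_less)
  have top: "j div 2 ^ n \<le> i div 2 ^ n \<longleftrightarrow> (bit j n \<longrightarrow> bit i n)"
    using ij by (auto simp: bit_iff_odd less_2_cases_iff)
  have low: "bit (l mod 2 ^ n) k = bit l k" if "k < n" for k l :: nat
    using that by (simp add: bit_take_bit_iff flip: take_bit_eq_mod)
  have "kronecker_power kernel_F (Suc n) $$ (i, j)
      = kernel_F $$ (i div 2 ^ n, j div 2 ^ n)
        * kronecker_power kernel_F n $$ (i mod 2 ^ n, j mod 2 ^ n)"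
    using Suc.prems K kernel_F_carrier by (auto simp: kronecker_def)
  also have "\<dots> = of_bool (bit j n \<longrightarrow> bit i n) * of_bool (\<forall>k<n. bit j k \<longrightarrow> bit i k)"
    using ij by (simp add: kernel_F_entry Suc.IH top low)
  also have "\<dots> = of_bool (\<forall>k<Suc n. bit j k \<longrightarrow> bit i k)"
    by (auto simp: less_Suc_eq)
  finally show ?case .
qed simp

section \<open>Bit reversal and the polar matrix\<close>

lemma bit_bit_reversal: "bit (bit_reversal n i) k \<longleftrightarrow> k < n \<and> bit i (n - Suc k)"
  by (auto simp: bit_reversal_def bit_horner_sum_bit_iff rev_nth)

lemma bit_reversal_less: "bit_reversal n i < 2 ^ n"
  using horner_sum_of_bool_2_less[of "rev (map (bit i) [0..<n])"]
  by (simp add: bit_reversal_def)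

lemma bit_reversal_bit_reversal: "i < 2 ^ n \<Longrightarrow> bit_reversal n (bit_reversal n i) = i"
proof (rule bit_eqI)
  fix k assume "i < 2 ^ n"
  then have "bit i k \<Longrightarrow> k < n"
    by (metis bit_take_bit_iff take_bit_nat_eq_self)
  then show "bit (bit_reversal n (bit_reversal n i)) k \<longleftrightarrow> bit i k"
    by (auto simp: bit_bit_reversal)
qed

lemma bit_reversal_mat_kronecker_power_kernel_F:
  "bit_reversal_mat n * kronecker_power kernel_F n * bit_reversal_mat n
     = kronecker_power kernel_F n"
proof (rule eq_matI)
  let ?B = "bit_reversal_mat n" and ?K = "kronecker_power kernel_F n"
  let ?r = "bit_reversal n"
  have K: "?K \<in> carrier_mat (2 ^ n) (2 ^ n)"
    by (rule kronecker_power_carrier[OF kernel_F_carrier])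
  show "dim_row (?B * ?K * ?B) = dim_row ?K" "dim_col (?B * ?K * ?B) = dim_col ?K"
    using K by (auto simp: bit_reversal_mat_def)
  fix i j assume "i < dim_row ?K" "j < dim_col ?K"
  then have ij: "i < 2 ^ n" "j < 2 ^ n" using K by auto
  have delta: "of_bool P * x = (if P then x else 0)" "x * of_bool P = (if P then x else 0)"
    for P and x :: bit by simp_all
  have BK: "(?B * ?K) $$ (i, k) = ?K $$ (?r i, k)" if "k < 2 ^ n" for k
    using that ij K bit_reversal_less[of n i]
    by (simp add: bit_reversal_mat_def scalar_prod_def delta del: mult_bit_eq_and)
  have "(?B * ?K * ?B) $$ (i, j)
      = (\<Sum>k = 0..<2 ^ n. (?B * ?K) $$ (i, k) * of_bool (j = ?r k))"
    using ij K by (simp add: bit_reversal_mat_def scalar_prod_def del: mult_bit_eq_and)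
  \<comment> \<open>Since reversal is an involution, j = r(k) is the same as k = r(j), which singles
    out one term of the sum.\<close>
  also have "\<dots> = (\<Sum>k = 0..<2 ^ n. ?K $$ (?r i, k) * of_bool (k = ?r j))"
    by (rule sum.cong) (use ij BK bit_reversal_bit_reversal in force)+
  also have "\<dots> = ?K $$ (?r i, ?r j)"
    using bit_reversal_less[of n j] by (simp add: delta del: mult_bit_eq_and)
  also have "\<dots> = ?K $$ (i, j)"
  proof -
    have "(\<forall>k<n. bit (?r j) k \<longrightarrow> bit (?r i) k) \<longleftrightarrow> (\<forall>k<n. bit j k \<longrightarrow> bit i k)"
    proof
      assume *: "\<forall>k<n. bit (?r j) k \<longrightarrow> bit (?r i) k"
      show "\<forall>k<n. bit j k \<longrightarrow> bit i k"
      proof (intro allI impI)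
        fix k assume "k < n" "bit j k"
        with *[rule_format, of "n - Suc k"] show "bit i k" by (simp add: bit_bit_reversal)
      qed
    qed (auto simp: bit_bit_reversal)
    then show ?thesis using ij by (simp add: kronecker_power_kernel_F_entry bit_reversal_less)
  qed
  finally show "(?B * ?K * ?B) $$ (i, j) = ?K $$ (i, j)" .
qed

lemma polar_mat_carrier: "polar_mat n \<in> carrier_mat (2 ^ n) (2 ^ n)"
  using kronecker_power_carrier[OF kernel_F_carrier, of n]
  by (auto simp: polar_mat_def bit_reversal_mat_def)

text \<open>With G = BK: GG = (BKB)K = KK = 1.\<close>

lemma polar_mat_square: "polar_mat n * polar_mat n = 1\<^sub>m (2 ^ n)"
proof -
  let ?B = "bit_reversal_mat n" and ?K = "kronecker_power kernel_F n"
  have K: "?K \<in> carrier_mat (2 ^ n) (2 ^ n)"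
    by (rule kronecker_power_carrier[OF kernel_F_carrier])
  have B: "?B \<in> carrier_mat (2 ^ n) (2 ^ n)" by (simp add: bit_reversal_mat_def)
  have "polar_mat n * polar_mat n = ?B * ?K * ?B * ?K"
    unfolding polar_mat_def using B K mult_carrier_mat[OF B K]
    by (intro assoc_mult_mat[symmetric])
  then show ?thesis
    by (simp add: bit_reversal_mat_kronecker_power_kernel_F kronecker_power_kernel_F_square)
qed

lemma length_polar_transform: "length (polar_transform n u) = 2 ^ n"
  using polar_mat_carrier[of n] by (simp add: polar_transform_def)

lemma polar_transform_involution:
  assumes "length u = 2 ^ n"
  shows "polar_transform n (polar_transform n u) = u"
proof -
  let ?G = "polar_mat n"
  have G: "transpose_mat ?G \<in> carrier_mat (2 ^ n) (2 ^ n)" using polar_mat_carrier by simp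
  have u: "vec_of_list u \<in> carrier_vec (2 ^ n)" using assms by (intro carrier_vecI) simp
  have "polar_transform n (polar_transform n u)
      = list_of_vec (transpose_mat ?G *\<^sub>v (transpose_mat ?G *\<^sub>v vec_of_list u))"
    by (simp add: polar_transform_def vec_list)
  also have "transpose_mat ?G *\<^sub>v (transpose_mat ?G *\<^sub>v vec_of_list u)
      = transpose_mat ?G * transpose_mat ?G *\<^sub>v vec_of_list u"
    using G u by (simp add: assoc_mult_mat_vec)
  also have "transpose_mat ?G * transpose_mat ?G = transpose_mat (?G * ?G)"
    by (simp add: transpose_mult[OF polar_mat_carrier polar_mat_carrier])
  also have "\<dots> = 1\<^sub>m (2 ^ n)" by (simp add: polar_mat_square)
  also have "1\<^sub>m (2 ^ n) *\<^sub>v vec_of_list u = vec_of_list u" using u by simp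
  finally show ?thesis by (simp add: list_vec)
qed

section \<open>The encoder\<close>

lemma finite_set_pmf_iid: "finite (set_pmf p) \<Longrightarrow> finite (set_pmf (iid p n))"
  by (auto simp: iid_def set_replicate_pmf lists_eq_set intro: finite_lists_length_eq)

lemma iid_X_vec: "map_pmf X_vec (iid p n) = replicate_pmf (2 ^ n) (map_pmf (fst \<circ> snd) p)"
  by (simp add: iid_def X_vec_def[abs_def] map_replicate_pmf)

lemma map_snd_eq_bind_cond_law:
  "map_pmf snd p = bind_pmf (map_pmf (fst \<circ> snd) p)
     (\<lambda>x. map_pmf (Pair x) (cond_law p (snd \<circ> snd) (fst \<circ> snd) x))"
proof -
  have "map_pmf snd p = map_pmf prod.swap (map_pmf (\<lambda>\<omega>. ((snd \<circ> snd) \<omega>, (fst \<circ> snd) \<omega>)) p)"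
    by (simp add: map_pmf_comp)
  then show ?thesis
    unfolding map_pmf_eq_bind_cond_law[of "snd \<circ> snd" "fst \<circ> snd" p] by (simp add: map_bind_pmf map_pmf_comp)
qed

text \<open>Disintegrate along (U, X); the Markov property then replaces the conditional law of Y by
  the one given X alone, at every pair of positive probability.\<close>

lemma markov_chain_eq_bind_cond_law:
  assumes "markov_chain p fst (fst \<circ> snd) (snd \<circ> snd)"
  shows "p = bind_pmf (map_pmf (\<lambda>(u, x, y). (u, x)) p)
     (\<lambda>w. map_pmf (\<lambda>y. (fst w, snd w, y)) (cond_law p (snd \<circ> snd) (fst \<circ> snd) (snd w)))"
proof -
  let ?W = "\<lambda>\<omega>. (fst \<omega>, (fst \<circ> snd) \<omega>)"
  have W: "(\<lambda>(u, x, y). (u, x)) = ?W" by auto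
  have "p = map_pmf (\<lambda>(y, w). (fst w, snd w, y)) (map_pmf (\<lambda>\<omega>. ((snd \<circ> snd) \<omega>, ?W \<omega>)) p)"
    by (simp add: map_pmf_comp)
  also have "\<dots> = bind_pmf (map_pmf ?W p)
      (\<lambda>w. map_pmf (\<lambda>y. (fst w, snd w, y)) (cond_law p (snd \<circ> snd) ?W w))"
    unfolding map_pmf_eq_bind_cond_law[of "snd \<circ> snd" ?W p] by (simp add: map_bind_pmf map_pmf_comp)
  also have "\<dots> = bind_pmf (map_pmf ?W p)
      (\<lambda>w. map_pmf (\<lambda>y. (fst w, snd w, y)) (cond_law p (snd \<circ> snd) (fst \<circ> snd) (snd w)))"
    by (rule bind_pmf_cong) (use assms in \<open>auto simp: markov_chain_def\<close>)
  finally show ?thesis unfolding W .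
qed

text \<open>The encoder draws X and Y together and then V from X. Given X, V and Y are independent,
  so Y can be drawn last, by the memoryless channel from X.\<close>

lemma encoder_law_eq_bind:
  "encoder_law p \<beta> d e n =
     bind_pmf (bind_pmf (map_pmf X_vec (iid p n)) (\<lambda>x. map_pmf (\<lambda>v. (v, x))
        (generate (encoder_step p \<beta> d e n x) (2 ^ n))))
       (\<lambda>w. map_pmf (\<lambda>y. (polar_transform n (fst w), snd w, y))
          (product_kernel (cond_law p (snd \<circ> snd) (fst \<circ> snd)) (snd w)))"
proof -
  let ?W = "cond_law p (snd \<circ> snd) (fst \<circ> snd)"
  let ?g = "\<lambda>x. generate (encoder_step p \<beta> d e n x) (2 ^ n)"
  have "replicate_pmf (2 ^ n) (map_pmf snd p)
      = bind_pmf (map_pmf X_vec (iid p n)) (\<lambda>x. map_pmf (map2 Pair x) (product_kernel ?W x))"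
    unfolding iid_X_vec map_snd_eq_bind_cond_law[of p]
    using replicate_pmf_bind_kernel[of "2 ^ n" "map_pmf (fst \<circ> snd) p" Pair ?W id] by simp
  then have "encoder_law p \<beta> d e n = bind_pmf (map_pmf X_vec (iid p n)) (\<lambda>x.
      bind_pmf (product_kernel ?W x) (\<lambda>y. bind_pmf (?g (map fst (map2 Pair x y))) (\<lambda>v.
      return_pmf (polar_transform n v, map fst (map2 Pair x y), map snd (map2 Pair x y)))))"
    by (simp add: encoder_law_def bind_assoc_pmf bind_map_pmf)
  also have "\<dots> = bind_pmf (map_pmf X_vec (iid p n)) (\<lambda>x. bind_pmf (product_kernel ?W x) (\<lambda>y.
      bind_pmf (?g x) (\<lambda>v. return_pmf (polar_transform n v, x, y))))"
    \<comment> \<open>The channel preserves length, so zipping and projecting recovers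
      \<open>x\<close> and \<open>y\<close>.\<close>
    by (intro bind_pmf_cong refl) (auto dest!: length_product_kernel)
  also have "\<dots> = bind_pmf (map_pmf X_vec (iid p n)) (\<lambda>x. bind_pmf (?g x) (\<lambda>v.
      bind_pmf (product_kernel ?W x) (\<lambda>y. return_pmf (polar_transform n v, x, y))))"
    by (intro bind_pmf_cong refl bind_commute_pmf)
  finally show ?thesis
    by (simp add: bind_assoc_pmf bind_map_pmf map_pmf_def bind_return_pmf)
qed

text \<open>The kernel is that of \<open>encoder_law_eq_bind\<close>: Y is drawn from X by the
  memoryless channel, and U is recovered from V because the transform is its own inverse.\<close>

lemma source_law_eq_bind:
  fixes p :: "(bit \<times> 'x \<times> 'y) pmf"
  assumes "markov_chain p fst (fst \<circ> snd) (snd \<circ> snd)"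
  shows "source_law p n =
     bind_pmf (map_pmf (\<lambda>\<omega>. (V_vec n \<omega>, X_vec \<omega>)) (iid p n))
       (\<lambda>w. map_pmf (\<lambda>y. (polar_transform n (fst w), snd w, y))
          (product_kernel (cond_law p (snd \<circ> snd) (fst \<circ> snd)) (snd w)))"
proof -
  let ?W = "cond_law p (snd \<circ> snd) (fst \<circ> snd)"
  let ?UX = "\<lambda>(u, x, y). (u, x)"
  let ?h = "\<lambda>w y. (fst w, snd w, y)"
  have "iid p n = replicate_pmf (2 ^ n) (bind_pmf (map_pmf ?UX p) (\<lambda>w. map_pmf (?h w) (?W (snd w))))"
    unfolding iid_def by (rule arg_cong[OF markov_chain_eq_bind_cond_law[OF assms]])
  also have "\<dots> = bind_pmf (map_pmf (map ?UX) (iid p n))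
      (\<lambda>w. map_pmf (map2 ?h w) (product_kernel ?W (map snd w)))"
    by (simp add: replicate_pmf_bind_kernel[of _ _ ?h ?W snd] map_replicate_pmf iid_def)
  finally have iid: "iid p n = \<dots>" .
  have "source_law p n = bind_pmf (map_pmf (map ?UX) (iid p n)) (\<lambda>w.
      map_pmf (\<lambda>y. (U_vec (map2 ?h w y), X_vec (map2 ?h w y), Y_vec (map2 ?h w y)))
        (product_kernel ?W (map snd w)))"
    unfolding source_law_def by (subst iid) (simp add: map_bind_pmf map_pmf_comp)
  also have "\<dots> = bind_pmf (map_pmf (map ?UX) (iid p n)) (\<lambda>w.
      map_pmf (\<lambda>y. (map fst w, map snd w, y)) (product_kernel ?W (map snd w)))"
  proof (intro bind_pmf_cong map_pmf_cong refl)
    fix w :: "(bit \<times> 'x) list" and y assume "y \<in> set_pmf (product_kernel ?W (map snd w))"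
    then have "length w = length y" by (auto dest: length_product_kernel)
    then show "(U_vec (map2 ?h w y), X_vec (map2 ?h w y), Y_vec (map2 ?h w y))
        = (map fst w, map snd w, y)"
      by (induction w y rule: list_induct2) (auto simp: U_vec_def X_vec_def Y_vec_def)
  qed
  also have "\<dots> = bind_pmf (iid p n) (\<lambda>\<omega>.
      map_pmf (\<lambda>y. (U_vec \<omega>, X_vec \<omega>, y)) (product_kernel ?W (X_vec \<omega>)))"
    by (simp add: bind_map_pmf U_vec_def X_vec_def comp_def case_prod_beta)
  also have "\<dots> = bind_pmf (iid p n) (\<lambda>\<omega>.
      map_pmf (\<lambda>y. (polar_transform n (V_vec n \<omega>), X_vec \<omega>, y)) (product_kernel ?W (X_vec \<omega>)))"
    by (intro bind_pmf_cong refl)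
      (auto simp: V_vec_def iid_def set_replicate_pmf polar_transform_involution U_vec_def)
  finally show ?thesis by (simp add: bind_map_pmf)
qed

lemma expectation_l1_dist_encoder_step_le:
  fixes p :: "(bit \<times> 'x \<times> 'y) pmf"
  assumes p: "finite (set_pmf p)" and j: "j < 2 ^ n"
  shows "measure_pmf.expectation (map_pmf (\<lambda>\<omega>. (take j (V_vec n \<omega>), X_vec \<omega>)) (iid p n))
           (\<lambda>w. l1_dist (encoder_step p \<beta> d e n (snd w) j (fst w))
             (cond_law (iid p n) (\<lambda>\<omega>. V_vec n \<omega> ! j) (\<lambda>\<omega>. (take j (V_vec n \<omega>), X_vec \<omega>)) w))
         \<le> 2 * sqrt (delta \<beta> n)"
proof -
  let ?M = "iid p n"
  let ?V = "\<lambda>\<omega>. take j (V_vec n \<omega>)" and ?T = "\<lambda>\<omega>. V_vec n \<omega> ! j"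
  let ?W = "\<lambda>\<omega>. (?V \<omega>, X_vec \<omega>)"
  have M: "finite (set_pmf ?M)" using p by (rule finite_set_pmf_iid)
  have \<delta>: "0 \<le> delta \<beta> n" "delta \<beta> n \<le> 1"
    using powr_mono[of "- (real (2 ^ n) powr \<beta>)" 0 2] by (simp_all add: delta_def)
  consider (random) "j \<in> F_r p \<beta> n" | (deterministic) "j \<notin> F_r p \<beta> n" "j \<in> F_d p \<beta> n"
    | (info) "j \<notin> F_r p \<beta> n" "j \<notin> F_d p \<beta> n" by blast
  then show ?thesis
  proof cases
    case random
    then have Z: "bhatt ?M ?T ?W \<ge> 1 - delta \<beta> n" by (simp add: F_r_def high_U_given_X_def)
    have "measure_pmf.expectation (map_pmf ?W ?M)
        (\<lambda>w. l1_dist (encoder_step p \<beta> d e n (snd w) j (fst w)) (cond_law ?M ?T ?W w))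
      = measure_pmf.expectation (map_pmf ?W ?M)
        (\<lambda>w. l1_dist (pmf_of_set {0, 1}) (cond_law ?M ?T ?W w))"
      using random by (simp add: encoder_step_def)
    also have "\<dots> \<le> sqrt (1 - (bhatt ?M ?T ?W)\<^sup>2)"
      by (rule expectation_l1_dist_uniform_le_bhatt[OF M])
    \<comment> \<open>1 - (1 - \<delta>)^2 is at most 2\<delta>; the looser 4\<delta> makes the root
      2 sqrt(\<delta>), a bound that also covers the next case.\<close>
    also have "\<dots> \<le> sqrt (2\<^sup>2 * delta \<beta> n)"
    proof (rule real_sqrt_le_mono)
      have "(1 - delta \<beta> n)\<^sup>2 \<le> (bhatt ?M ?T ?W)\<^sup>2" using Z \<delta> by (intro power_mono) auto
      moreover have "1 - (1 - delta \<beta> n)\<^sup>2 \<le> 2\<^sup>2 * delta \<beta> n"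
        using \<delta> by (simp add: power2_eq_square algebra_simps)
      ultimately show "1 - (bhatt ?M ?T ?W)\<^sup>2 \<le> 2\<^sup>2 * delta \<beta> n" by linarith
    qed
    also have "\<dots> = 2 * sqrt (delta \<beta> n)" by (simp add: real_sqrt_mult)
    finally show ?thesis .
  next
    case deterministic
    then have Z: "bhatt ?M ?T ?V \<le> delta \<beta> n" by (simp add: F_d_def low_U_def)
    \<comment> \<open>A pair (v, x) of positive probability has a past v of positive probability, so
      the default law \<open>d\<close> is never consulted.\<close>
    have "measure_pmf.expectation (map_pmf ?W ?M)
        (\<lambda>w. l1_dist (encoder_step p \<beta> d e n (snd w) j (fst w)) (cond_law ?M ?T ?W w))
      = measure_pmf.expectation (map_pmf ?W ?M)
        (\<lambda>w. l1_dist (cond_law ?M ?T ?V (fst w)) (cond_law ?M ?T ?W w))"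
      using deterministic
      by (intro integral_cong_AE)
        (auto simp: AE_measure_pmf_iff encoder_step_def cond_law_or_def)
    also have "\<dots> \<le> 2 * bhatt ?M ?T ?V"
      by (rule expectation_l1_dist_refinement_le_bhatt[OF M])
    also have "\<dots> \<le> 2 * sqrt (delta \<beta> n)"
    proof -
      have "delta \<beta> n \<le> sqrt (delta \<beta> n)"
        using \<delta> by (intro real_le_rsqrt) (simp add: power2_eq_square mult_left_le)
      with Z show ?thesis by simp
    qed
    finally show ?thesis .
  next
    case info
    then have "measure_pmf.expectation (map_pmf ?W ?M)
        (\<lambda>w. l1_dist (encoder_step p \<beta> d e n (snd w) j (fst w)) (cond_law ?M ?T ?W w))
      = measure_pmf.expectation (map_pmf ?W ?M) (\<lambda>w. 0)"
      by (intro integral_cong_AE)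
        (auto simp: AE_measure_pmf_iff encoder_step_def cond_law_or_def)
    then show ?thesis using \<delta> by simp
  qed
qed

lemma l1_dist_encoder_law_le:
  fixes p :: "(bit \<times> 'x \<times> 'y) pmf"
  assumes p: "finite (set_pmf p)" and markov: "markov_chain p fst (fst \<circ> snd) (snd \<circ> snd)"
  shows "l1_dist (encoder_law p \<beta> d e n) (source_law p n) \<le> 2 ^ n * (2 * sqrt (delta \<beta> n))"
proof -
  let ?M = "iid p n" and ?C = "cond_law p (snd \<circ> snd) (fst \<circ> snd)"
  let ?K = "\<lambda>w. map_pmf (\<lambda>y. (polar_transform n (fst w), snd w, y)) (product_kernel ?C (snd w))"
  let ?Q = "bind_pmf (map_pmf X_vec ?M) (\<lambda>x. map_pmf (\<lambda>v. (v, x))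
        (generate (encoder_step p \<beta> d e n x) (2 ^ n)))"
  \<comment> \<open>Taking 2^n coordinates leaves V unchanged; the form matches
    \<open>l1_dist_generate_le\<close> at its last index.\<close>
  let ?P = "map_pmf (\<lambda>\<omega>. (take (2 ^ n) (V_vec n \<omega>), X_vec \<omega>)) ?M"
  have M: "finite (set_pmf ?M)" using p by (rule finite_set_pmf_iid)
  have Q: "finite (set_pmf ?Q)" using M by (auto intro!: finite_set_pmf_generate)
  have X: "set (X_vec \<omega>) \<subseteq> (fst \<circ> snd) ` set_pmf p" if "\<omega> \<in> set_pmf ?M" for \<omega>
    using that by (force simp: iid_def set_replicate_pmf X_vec_def)
  have C: "finite (set_pmf (?C x))" if "x \<in> (fst \<circ> snd) ` set_pmf p" for x
  proof -
    have "set_pmf p \<inter> {\<omega>. (fst \<circ> snd) \<omega> = x} \<noteq> {}" using that by auto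
    then show ?thesis unfolding cond_law_def using p by simp
  qed
  \<comment> \<open>Both laws have the same X-marginal, so only words over the support of X reach
    the channel, where its transition laws are genuine conditional laws.\<close>
  have K: "finite (set_pmf (?K w))" if "w \<in> set_pmf ?Q \<union> set_pmf ?P" for w
  proof -
    obtain \<omega> where "\<omega> \<in> set_pmf ?M" "snd w = X_vec \<omega>" using \<open>w \<in> _\<close> by auto
    then have "finite (set_pmf (product_kernel ?C (snd w)))"
      by (intro finite_set_pmf_product_kernel C subsetD[OF X]) simp_all
    then show ?thesis by simp
  qed
  have "source_law p n = bind_pmf ?P ?K"
    unfolding source_law_eq_bind[OF markov] by (simp add: V_vec_def length_polar_transform)
  then have "l1_dist (encoder_law p \<beta> d e n) (source_law p n)
      = l1_dist (bind_pmf ?Q ?K) (bind_pmf ?P ?K)"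
    by (simp only: encoder_law_eq_bind)
  also have "\<dots> \<le> l1_dist ?Q ?P"
    by (rule l1_dist_bind_same_le[OF Q _ K]) (use M in auto)
  also have "\<dots> \<le> (\<Sum>j<(2 ^ n :: nat). 2 * sqrt (delta \<beta> n))"
  proof (rule order_trans[OF l1_dist_generate_le[OF M]])
    show "2 ^ n \<le> length (V_vec n \<omega>)" for \<omega> :: "(bit \<times> 'x \<times> 'y) list"
      by (simp add: V_vec_def length_polar_transform)
  qed (simp, rule sum_mono, rule expectation_l1_dist_encoder_step_le[OF p], simp)
  also have "\<dots> = 2 ^ n * (2 * sqrt (delta \<beta> n))" by simp
  finally show ?thesis .
qed

theorem lemma4:
  fixes p :: "(bit \<times> 'x \<times> 'y) pmf"
    and \<X> :: "'x set" and \<Y> :: "'y set"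
    and \<beta> \<beta>\<^sub>1 :: real
    and d :: "nat \<Rightarrow> nat \<Rightarrow> bit list \<Rightarrow> bit pmf"
    and e :: "nat \<Rightarrow> nat \<Rightarrow> bit list \<times> 'x list \<Rightarrow> bit pmf"
  assumes "finite \<X>" and "finite \<Y>"
    and "set_pmf p \<subseteq> UNIV \<times> \<X> \<times> \<Y>"
    and "markov_chain p fst (fst \<circ> snd) (snd \<circ> snd)"
    and "0 < \<beta>\<^sub>1" and "\<beta>\<^sub>1 < \<beta>" and "\<beta> < 1/2"
  shows "(\<lambda>n. l1_dist (encoder_law p \<beta> d e n) (source_law p n))
           \<in> O(\<lambda>n. 2 powr - (real (2 ^ n) powr \<beta>\<^sub>1))"
proof -
  have p: "finite (set_pmf p)"
    by (rule finite_subset[OF assms(3)]) (use assms(1,2) in simp)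
  \<comment> \<open>The comparison is made in a real variable x and then specialised to x = N = 2^n.
    It holds because x^\<beta> / 2 exceeds x^\<open>\<beta>\<^sub>1\<close> by more than any
    multiple of log x.\<close>
  have "(\<lambda>x::real. x * (2 * 2 powr (- (x powr \<beta>) / 2))) \<in> O(\<lambda>x. 2 powr - (x powr \<beta>\<^sub>1))"
    using assms(5,6) by real_asymp
  moreover have "filterlim (\<lambda>n. 2 ^ n :: real) at_top sequentially" by real_asymp
  ultimately have O: "(\<lambda>n. 2 ^ n * (2 * 2 powr (- ((2 ^ n) powr \<beta>) / 2)))
      \<in> O(\<lambda>n. 2 powr - ((2 ^ n :: real) powr \<beta>\<^sub>1))"
    by (rule landau_o.big.compose)
  have sqrt: "sqrt (delta \<beta> n) = 2 powr (- ((2 ^ n) powr \<beta>) / 2)" for n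
    by (simp add: delta_def powr_half_sqrt[symmetric] powr_powr)
  have "(\<lambda>n. l1_dist (encoder_law p \<beta> d e n) (source_law p n))
      \<in> O(\<lambda>n. 2 ^ n * (2 * 2 powr (- ((2 ^ n) powr \<beta>) / 2)))"
  proof (rule landau_o.big_mono, rule always_eventually, rule allI)
    fix n
    show "norm (l1_dist (encoder_law p \<beta> d e n) (source_law p n))
        \<le> norm (2 ^ n * (2 * 2 powr (- ((2 ^ n) powr \<beta>) / 2)) :: real)"
      using l1_dist_encoder_law_le[OF p assms(4), of \<beta> d e n]
      by (simp add: l1_dist_nonneg sqrt)
  qed
  from landau_o.big_trans[OF this O] show ?thesis by simp
qed

end
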